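(* Let $\mathcal T$ be a conformingly marked AMP mesh (a descendant mesh of an initial AMP marked mesh), let $\mathcal M\subseteq\mathcal T$, and consider the call $\mathtt{RefineAMP}(\mathcal T,\mathcal M)$. Let $K$ be the tetrahedron bisected by a non-root event of this call. Immediately before that event there exist an edge $e\in\mathcal E(K)$ and a hanging vertex $b=\operatorname{mid}(e)$ of $K$ such that an earlier event in the same call bisected the geometric edge $e$ and created $b$.
   Context: **Notation.** Tetrahedra are closed and nondegenerate in $\mathbb R^3$; $[v_0,v_1,\dots]$ is the convex hull; $\mathcal V(X),\mathcal E(X),\mathcal F(X)$ are the sets of vertices, edges, triangular faces of a tetrahedron or mesh $X$; $\operatorname{mid}(e)$ is the midpoint of $e$. **Marked tetrahedron.** A tetrahedron $K$ with a refinement edge $e(K)\in\mathcal E(K)$, a marked edge $\mu_F\in\mathcal E(F)$ for every $F\in\mathcal F(K)$, and a Boolean flag, such that the two faces containing $e(K)$ (refinement faces) have mark $e(K)$; the flag may be set only if the four face marks are coplanar. The other two faces are the nonrefinement faces. Types: $P$ if all face marks are coplanar ($P_u$ flag unset, $P_f$ flag set); $A$ if the marks of both nonrefinement faces meet $e(K)$ but the four marks are not coplanar; $O$ if neither of these two marks meets $e(K)$; $M$ if exactly one does. **Bisection.** For $K=[v_0,v_1,v_2,v_3]$ with $e(K)=[v_0,v_1]$ and $m=\operatorname{mid}([v_0,v_1])$, the children are $K_0=[v_0,m,v_2,v_3]$ and $K_1=[m,v_1,v_2,v_3]$, marked as follows: (B1) the inherited face of a child (a face of $K$) keeps its mark,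 and this mark is the refinement edge of the child; (B2) a cut face (a proper subtriangle of a face of $K$) is marked by its edge opposite $m$; (B3) the common new face $[m,v_2,v_3]$ is marked by $[v_2,v_3]$, except if $K$ has type $P_f$, when it is marked by $[m,w]$ with $w\in\{v_2,v_3\}$ the common old endpoint of the two child refinement edges; (B4) the child flags are set iff $K$ has type $P_u$. **Meshes.** A tetrahedral mesh of a polyhedral domain $\Omega\subset\mathbb R^3$ is a finite collection of tetrahedra with pairwise disjoint interiors and union $\overline\Omega$. It is conforming if two distinct elements intersect in the empty set, a common vertex, a common edge or a common face. An AMP marked mesh is a mesh of marked tetrahedra; it is conformingly marked if it is conforming and any shared face gets the same mark from both sides. An *initial AMP marked mesh* is a finite conformingly marked AMP mesh with all flags unset. A descendant mesh of it is the mesh of leaves after finitely many bisections starting from it. **RefineAMP and events.** A hanging vertex of an element $K$ of a current mesh $\widetilde{\mathcal T}$ is a vertex $z\in\mathcal V(\widetilde{\mathcal T})$ with $z\in\partial K\setminus\mathcal V(K)$. $\mathtt{RefineAMP}(\mathcal T,\mathcal M)$: batch zero bisects all elements of $\mathcal M$; then, as long as some elements of the current mesh have hanging vertices, the next batch simultaneously bisects all of them. Each bisection is an event; batch-zero events are root events, all others are non-root. An event bisecting $K'$ "bisects the geometric edge $e$" if $e(K')=e$. "Immediately before the event" refers to the intermediate mesh just before the batch containing the event; "earlier" means in an earlier batch. *)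

theory Defs
  imports "HOL-Analysis.Analysis"
begin

text \<open>
  A simplex is represented by its finite vertex set; the geometric object is the convex hull
  of that set.  For affinely independent vertices this loses nothing.
\<close>

type_synonym point = "real^3"

definition edges :: "point set \<Rightarrow> point set set" where
  "edges X = {e. e \<subseteq> X \<and> card e = 2}"

definition faces :: "point set \<Rightarrow> point set set" where
  "faces V = {F. F \<subseteq> V \<and> card F = 3}"

text \<open>Edges are unordered, so the midpoint is half the sum of the two endpoints.\<close>

definition mid :: "point set \<Rightarrow> point" where
  "mid e = (1/2) *\<^sub>R (\<Sum>v\<in>e. v)"

lemma mid_pair: "a \<noteq> b \<Longrightarrow> mid {a, b} = midpoint a b"
  by (simp add: mid_def midpoint_def)

datatype marked_tet =
  MTet (verts: "point set") (redge: "point set") (mark: "point set \<Rightarrow> point set") (flag: bool)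

abbreviation solid :: "marked_tet \<Rightarrow> point set" where
  "solid K \<equiv> convex hull (verts K)"

definition type_P :: "marked_tet \<Rightarrow> bool" where
  "type_P K \<longleftrightarrow> coplanar (\<Union>F\<in>faces (verts K). mark K F)"

definition type_Pu :: "marked_tet \<Rightarrow> bool" where
  "type_Pu K \<longleftrightarrow> type_P K \<and> \<not> flag K"

definition type_Pf :: "marked_tet \<Rightarrow> bool" where
  "type_Pf K \<longleftrightarrow> type_P K \<and> flag K"

text \<open>
  The marking is extensional (\<open>undefined\<close> off the faces), so that equality of values of type
  \<^typ>\<open>marked_tet\<close> is equality of marked tetrahedra.
\<close>

definition is_marked_tet :: "marked_tet \<Rightarrow> bool" where
  "is_marked_tet K \<longleftrightarrow>
     card (verts K) = 4 \<and> \<not> affine_dependent (verts K) \<and>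
     redge K \<in> edges (verts K) \<and>
     mark K \<in> (\<Pi>\<^sub>E F\<in>faces (verts K). edges F) \<and>
     (\<forall>F\<in>faces (verts K). redge K \<subseteq> F \<longrightarrow> mark K F = redge K) \<and>
     (flag K \<longrightarrow> type_P K)"

text \<open>
  The nonrefinement face containing the endpoint \<open>a\<close> of the refinement edge; it is
  the face of \<open>K\<close> inherited by the child at \<open>a\<close>.
\<close>

definition inherited_face :: "marked_tet \<Rightarrow> point \<Rightarrow> point set" where
  "inherited_face K a = verts K - (redge K - {a})"

text \<open>
  In type \<open>P\<^sub>f\<close> the two nonrefinement marks, which become the refinement edges of the
  children, share exactly one vertex off the refinement edge; \<open>THE\<close> selects it.
\<close>

definition new_face_mark :: "marked_tet \<Rightarrow> point set" where
  "new_face_mark K =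
     (if type_Pf K
      then {mid (redge K),
            THE w. w \<in> verts K - redge K \<and> (\<forall>a\<in>redge K. w \<in> mark K (inherited_face K a))}
      else verts K - redge K)"

text \<open>
  With \<open>m = mid (redge K)\<close>, the faces of the child at \<open>a\<close> are the inherited face (the one
  avoiding \<open>m\<close>), two cut faces (containing both \<open>m\<close> and \<open>a\<close>) and the new face
  (containing \<open>m\<close> but not \<open>a\<close>).
\<close>

definition child :: "marked_tet \<Rightarrow> point \<Rightarrow> marked_tet" where
  "child K a =
     (let m = mid (redge K); V = insert m (inherited_face K a) in
      MTet V
        (mark K (inherited_face K a))
        (\<lambda>F\<in>faces V.
           if m \<notin> F then mark K F
           else if a \<in> F then F - {m}
           else new_face_mark K)
        (type_Pu K))"

definition children :: "marked_tet \<Rightarrow> marked_tet set" where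
  "children K = child K ` redge K"

definition mesh_verts :: "marked_tet set \<Rightarrow> point set" where
  "mesh_verts T = (\<Union>K\<in>T. verts K)"

definition polyhedral_domain :: "point set \<Rightarrow> bool" where
  "polyhedral_domain \<Omega> \<longleftrightarrow> open \<Omega> \<and> connected \<Omega> \<and> \<Omega> \<noteq> {} \<and>
     (\<exists>\<P>. finite \<P> \<and> (\<forall>P\<in>\<P>. polytope P) \<and> closure \<Omega> = \<Union>\<P>)"

definition amp_mesh_of :: "point set \<Rightarrow> marked_tet set \<Rightarrow> bool" where
  "amp_mesh_of \<Omega> T \<longleftrightarrow> finite T \<and> (\<forall>K\<in>T. is_marked_tet K) \<and>
     (\<forall>K\<in>T. \<forall>K'\<in>T. K \<noteq> K' \<longrightarrow> interior (solid K) \<inter> interior (solid K') = {}) \<and>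
     (\<Union>K\<in>T. solid K) = closure \<Omega>"

definition conforming :: "marked_tet set \<Rightarrow> bool" where
  "conforming T \<longleftrightarrow> (\<forall>K\<in>T. \<forall>K'\<in>T. K \<noteq> K' \<longrightarrow>
     solid K \<inter> solid K' = {} \<or>
     (\<exists>v\<in>verts K \<inter> verts K'. solid K \<inter> solid K' = {v}) \<or>
     (\<exists>e\<in>edges (verts K) \<inter> edges (verts K'). solid K \<inter> solid K' = convex hull e) \<or>
     (\<exists>F\<in>faces (verts K) \<inter> faces (verts K'). solid K \<inter> solid K' = convex hull F))"

definition conformingly_marked :: "point set \<Rightarrow> marked_tet set \<Rightarrow> bool" where
  "conformingly_marked \<Omega> T \<longleftrightarrow> amp_mesh_of \<Omega> T \<and> conforming T \<and>
     (\<forall>K\<in>T. \<forall>K'\<in>T. \<forall>F\<in>faces (verts K) \<inter> faces (verts K'). mark K F = mark K' F)"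

definition initial_amp_mesh :: "point set \<Rightarrow> marked_tet set \<Rightarrow> bool" where
  "initial_amp_mesh \<Omega> T \<longleftrightarrow> conformingly_marked \<Omega> T \<and> (\<forall>K\<in>T. \<not> flag K)"

definition bisect_batch :: "marked_tet set \<Rightarrow> marked_tet set \<Rightarrow> marked_tet set" where
  "bisect_batch T B = (T - B) \<union> (\<Union>K\<in>B. children K)"

inductive descendant_mesh :: "marked_tet set \<Rightarrow> marked_tet set \<Rightarrow> bool" for T\<^sub>0 where
  refl: "descendant_mesh T\<^sub>0 T\<^sub>0"
| bisect: "descendant_mesh T\<^sub>0 T \<Longrightarrow> K \<in> T \<Longrightarrow> descendant_mesh T\<^sub>0 (bisect_batch T {K})"

definition hanging_vertex :: "marked_tet set \<Rightarrow> marked_tet \<Rightarrow> point \<Rightarrow> bool" where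
  "hanging_vertex T K z \<longleftrightarrow> z \<in> mesh_verts T \<and> z \<in> frontier (solid K) - verts K"

definition next_batch :: "marked_tet set \<Rightarrow> nat \<Rightarrow> marked_tet set \<Rightarrow> marked_tet set" where
  "next_batch M n T = (if n = 0 then M else {K \<in> T. \<exists>z. hanging_vertex T K z})"

text \<open>
  \<open>refine_mesh T M n\<close> is the mesh immediately before batch \<open>n\<close> of the call with arguments
  \<open>T\<close> and \<open>M\<close>.  Once no element has a hanging vertex all further batches are empty
  and the mesh is stationary, which corresponds to the call having stopped.
\<close>

primrec refine_mesh :: "marked_tet set \<Rightarrow> marked_tet set \<Rightarrow> nat \<Rightarrow> marked_tet set" where
  "refine_mesh T M 0 = T"
| "refine_mesh T M (Suc n) =
     bisect_batch (refine_mesh T M n) (next_batch M n (refine_mesh T M n))"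

text \<open>
  An event is a batch number with an element bisected in that batch; it is a root event iff
  the batch number is \<open>0\<close>.
\<close>

definition refine_event :: "marked_tet set \<Rightarrow> marked_tet set \<Rightarrow> nat \<Rightarrow> marked_tet \<Rightarrow> bool" where
  "refine_event T M n K \<longleftrightarrow> K \<in> next_batch M n (refine_mesh T M n)"

text \<open>
  The point is a vertex of a child but was not a vertex of the mesh before the batch.  Several
  events of one batch may create the same vertex.
\<close>

definition event_creates :: "marked_tet set \<Rightarrow> marked_tet set \<Rightarrow> nat \<Rightarrow> marked_tet \<Rightarrow> point \<Rightarrow> bool" where
  "event_creates T M n K b \<longleftrightarrow>
     b \<in> mesh_verts (children K) \<and> b \<notin> mesh_verts (refine_mesh T M n)"

end

theory Submission
  imports Defs
begin

text \<open>
  Let \<open>z\<close> be the first vertex on the boundary of \<open>K\<close> that is not a vertex of \<open>K\<close>, created by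
  bisecting an edge \<open>e\<close> of some \<open>K'\<close>.  The elements \<open>K\<close> and \<open>K'\<close> descend from \<open>A\<close> and \<open>A'\<close>
  whose intersection is a common subsimplex \<open>S\<close> with one and the same mark: either both are
  elements of the input mesh, or they are siblings.  Every refinement induces on a face of an
  ancestor the newest vertex bisection tree fixed by the mark of that face, and on an edge the dyadic
  subdivision.  Edges of such a tree are laminar: one whose midpoint lies in the relative
  interior of a simplex of the tree is contained in that simplex.  Hence \<open>e\<close> lies on the boundary
  of \<open>K\<close>.  Its endpoints existed before \<open>z\<close>, so they are vertices of \<open>K\<close>, and \<open>e\<close> is an edge
  of \<open>K\<close> with midpoint \<open>z\<close>.
\<close>

section \<open>Halving a simplex\<close>

text \<open>Works for a vertex set of any size, so that tetrahedra, triangles and segments share the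
  lemmas; \<open>a\<close> is the endpoint of \<open>e\<close> that is kept. A segment is cut as
  \<open>halve g g a\<close>.\<close>

definition halve :: "point set \<Rightarrow> point set \<Rightarrow> point \<Rightarrow> point set" where
  "halve V e a = insert (mid e) (V - (e - {a}))"

lemma pair_at:
  assumes "card e = 2" "a \<in> e"
  obtains b where "b \<noteq> a" "e = {a, b}"
  using assms by (metis card_2_iff doubleton_eq_iff insertE singletonD)

lemma mid_in_open_segment:
  assumes "a \<noteq> b"
  shows "mid {a, b} \<in> open_segment a b"
  using assms by (simp add: mid_pair midpoint_in_open_segment)

lemma mid_in_convex_hull:
  assumes "card e = 2"
  shows "mid e \<in> convex hull e"
proof -
  obtain a b where "a \<noteq> b" "e = {a, b}" using assms by (meson card_2_iff)
  then show ?thesis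
    by (metis mid_in_open_segment open_closed_segment segment_convex_hull)
qed

text \<open>The midpoint lies in the open segment, and a face that meets an open segment of the
  ambient set contains both endpoints.\<close>

lemma face_of_edgeD:
  assumes "C face_of D" "card e = 2" "e \<subseteq> D" "mid e \<in> C"
  shows "e \<subseteq> C"
proof -
  obtain a b where "a \<noteq> b" "e = {a, b}" using assms by (meson card_2_iff)
  then show ?thesis
    using mid_in_open_segment[of a b] face_ofD[OF assms(1), of "mid e" a b] assms by auto
qed

text \<open>Since \<open>b\<close> is twice the midpoint minus \<open>a\<close>, it would otherwise
  be an affine combination of the other vertices.\<close>

lemma mid_notin_affine_hull:
  assumes "\<not> affine_dependent V" "a \<in> V" "b \<in> V" "a \<noteq> b"
  shows "mid {a, b} \<notin> affine hull (V - {b})"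
proof
  assume m: "mid {a, b} \<in> affine hull (V - {b})"
  have "a \<in> affine hull (V - {b})" using assms by (auto intro: hull_inc)
  then have "(-1) *\<^sub>R a + 2 *\<^sub>R mid {a, b} \<in> affine hull (V - {b})"
    by (intro mem_affine[OF affine_affine_hull _ m]) auto
  moreover have "(-1) *\<^sub>R a + 2 *\<^sub>R mid {a, b} = b"
    using assms by (simp add: mid_def)
  ultimately show False using assms by (auto simp: affine_dependent_def)
qed

context
  fixes V e :: "point set"
  assumes indep: "\<not> affine_dependent V" and e: "e \<subseteq> V" "card e = 2"
begin

lemma mid_notin: "mid e \<notin> V"
proof
  assume m: "mid e \<in> V"
  obtain a b where ab: "a \<noteq> b" "e = {a, b}" using e by (meson card_2_iff)
  have "mid {a, b} \<noteq> b" using mid_in_open_segment[OF ab(1)] by (auto simp: open_segment_def)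
  then have "mid {a, b} \<in> affine hull (V - {b})" using m ab by (auto intro: hull_inc)
  then show False using mid_notin_affine_hull[OF indep, of a b] ab e by auto
qed

lemma affine_independent_halve:
  assumes "a \<in> e"
  shows "\<not> affine_dependent (halve V e a)"
proof -
  obtain b where b: "b \<noteq> a" "e = {a, b}" using pair_at e(2) assms by metis
  then have "mid e \<notin> affine hull (V - {b})" using mid_notin_affine_hull[OF indep, of a b] e by auto
  moreover have "e - {a} = {b}" using b by auto
  ultimately show ?thesis unfolding halve_def
    using indep by (metis affine_independent_insert affine_independent_Diff)
qed

lemma card_halve:
  assumes "a \<in> e"
  shows "card (halve V e a) = card V"
proof -
  obtain b where b: "b \<noteq> a" "e = {a, b}" using pair_at e(2) assms by metis
  then have "e - {a} = {b}" by auto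
  then show ?thesis unfolding halve_def
    using aff_independent_finite[OF indep] mid_notin e b card_Suc_Diff1[of V b] by simp
qed

lemma convex_hull_halve_subset: "convex hull (halve V e a) \<subseteq> convex hull V"
proof (rule hull_minimal)
  have "mid e \<in> convex hull V" using mid_in_convex_hull[OF e(2)] e(1) hull_mono by blast
  then show "halve V e a \<subseteq> convex hull V" by (auto simp: halve_def hull_inc)
qed (rule convex_convex_hull)

text \<open>Barycentric coordinates are unique. In one half a common point has no weight at
  \<open>b\<close>, in the other none at \<open>a\<close>; comparing both expansions kills the
  weight of \<open>a\<close> as well.\<close>

lemma convex_hull_halves_Int:
  assumes "a \<in> e" "b \<in> e" "a \<noteq> b"
  shows "convex hull (halve V e a) \<inter> convex hull (halve V e b)
       = convex hull (insert (mid e) (V - e))"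
proof
  have eab: "e = {a, b}" using pair_at[OF e(2) assms(1)] assms by auto
  let ?m = "mid e" and ?R = "V - e"
  have fin: "finite ?R" "finite V" using aff_independent_finite[OF indep] by auto
  have m: "?m \<notin> V" by (rule mid_notin)
  have Va: "halve V e a = insert a (insert ?m ?R)" and Vb: "halve V e b = insert b (insert ?m ?R)"
    using eab assms e by (auto simp: halve_def)
  show "convex hull (insert ?m ?R) \<subseteq> convex hull (halve V e a) \<inter> convex hull (halve V e b)"
    unfolding Va Vb by (auto intro: subsetD[OF hull_mono, rotated])
  show "convex hull (halve V e a) \<inter> convex hull (halve V e b) \<subseteq> convex hull (insert ?m ?R)"
  proof
    fix z assume z: "z \<in> convex hull (halve V e a) \<inter> convex hull (halve V e b)"
    have nin: "a \<notin> ?R" "b \<notin> ?R" "?m \<notin> ?R" "a \<noteq> ?m" "b \<noteq> ?m" using eab m e by auto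
    obtain u where u: "\<forall>x\<in>insert a (insert ?m ?R). 0 \<le> u x" "sum u (insert a (insert ?m ?R)) = 1"
      "(\<Sum>x\<in>insert a (insert ?m ?R). u x *\<^sub>R x) = z"
      using z fin unfolding Va by (auto simp: convex_hull_finite simp del: insert_iff)
    obtain w where w: "\<forall>x\<in>insert b (insert ?m ?R). 0 \<le> w x" "sum w (insert b (insert ?m ?R)) = 1"
      "(\<Sum>x\<in>insert b (insert ?m ?R). w x *\<^sub>R x) = z"
      using z fin unfolding Vb by (auto simp: convex_hull_finite simp del: insert_iff)
    \<comment> \<open>The difference of the two coordinate vectors of \<open>z\<close> with respect
      to \<open>V\<close>, the weight of the midpoint being split evenly between \<open>a\<close>
      and \<open>b\<close>.\<close>
    define U where "U = (\<lambda>x. if x = a then u a + u ?m / 2 - w ?m / 2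
                         else if x = b then u ?m / 2 - w b - w ?m / 2 else u x - w x)"
    have V: "V = insert a (insert b ?R)" using eab e by auto
    have UR: "x \<in> ?R \<Longrightarrow> U x = u x - w x" for x using eab by (auto simp: U_def)
    have mm: "?m = (1/2) *\<^sub>R a + (1/2) *\<^sub>R b"
      using eab assms by (simp add: mid_def algebra_simps)
    have "sum U V = 0"
    proof -
      have "sum U V = U a + U b + (sum u ?R - sum w ?R)"
        using fin nin assms UR by (subst V) (simp add: sum_subtractf)
      then show ?thesis using u(2) w(2) fin nin assms by (simp add: U_def)
    qed
    moreover have "(\<Sum>x\<in>V. U x *\<^sub>R x) = 0"
    proof -
      have "(\<Sum>x\<in>V. U x *\<^sub>R x) = U a *\<^sub>R a + U b *\<^sub>R b
          + ((\<Sum>x\<in>?R. u x *\<^sub>R x) - (\<Sum>x\<in>?R. w x *\<^sub>R x))"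
        using fin nin assms UR
        by (subst V) (simp add: sum_subtractf scaleR_left_diff_distrib add.assoc)
      moreover have "u a *\<^sub>R a + (u ?m *\<^sub>R ?m + (\<Sum>x\<in>?R. u x *\<^sub>R x))
          = w b *\<^sub>R b + (w ?m *\<^sub>R ?m + (\<Sum>x\<in>?R. w x *\<^sub>R x))"
        using u(3) w(3) fin nin assms by simp
      moreover have "u ?m *\<^sub>R ?m = (u ?m / 2) *\<^sub>R a + (u ?m / 2) *\<^sub>R b"
          "w ?m *\<^sub>R ?m = (w ?m / 2) *\<^sub>R a + (w ?m / 2) *\<^sub>R b"
        by (subst (2) mm, simp add: algebra_simps)+
      ultimately show ?thesis using assms by (simp add: U_def algebra_simps)
    qed
    ultimately have U0: "\<forall>x\<in>V. U x = 0"
      using indep fin by (auto simp: affine_dependent_explicit_finite)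
    \<comment> \<open>Subtracting the two equations leaves \<open>u a + w b = 0\<close>, a sum of
      nonnegative terms.\<close>
    have "U a = 0" "U b = 0" using U0 V by auto
    then have "u a = 0" using u(1) w(1) assms by (simp add: U_def)
    then have "sum u (insert ?m ?R) = 1" "(\<Sum>x\<in>insert ?m ?R. u x *\<^sub>R x) = z"
      using u(2,3) nin fin by auto
    then show "z \<in> convex hull (insert ?m ?R)"
      using u(1) fin by (auto simp: convex_hull_finite intro!: exI[of _ u])
  qed
qed

text \<open>A face that contains the midpoint contains the cut edge, so the bisection restricts to a
  bisection of the part of \<open>V\<close> in \<open>C\<close>; otherwise that part can only lose
  an endpoint.\<close>

lemma halve_Int_face:
  assumes "a \<in> e" "C face_of D" "V \<subseteq> D"
  shows "halve V e a \<inter> C = (if mid e \<in> C then halve (V \<inter> C) e a else V \<inter> C - (e - {a}))"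
    and "mid e \<in> C \<Longrightarrow> e \<subseteq> V \<inter> C"
  using face_of_edgeD[OF assms(2) e(2)] e assms by (auto simp: halve_def)

end

section \<open>Vertices and faces of simplices\<close>

lemma vertex_in_hull:
  fixes V W :: "point set"
  assumes "\<not> affine_dependent V" "v \<in> V" "v \<in> convex hull W" "convex hull W \<subseteq> convex hull V"
  shows "v \<in> W"
proof -
  have "v extreme_point_of (convex hull V)"
    using assms(1,2) by (simp add: extreme_point_of_convex_hull_affine_independent)
  \<comment> \<open>An extreme point of a set stays extreme in every subset that contains
    it.\<close>
  then have "v extreme_point_of (convex hull W)"
    using assms(3,4) by (auto simp: extreme_point_of_def)
  then show ?thesis by (rule extreme_point_of_convex_hull)
qed

lemma face_of_subhull:
  fixes V :: "point set"
  assumes "\<not> affine_dependent V" "S \<subseteq> V"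
  shows "convex hull S face_of convex hull V"
  using assms face_of_convex_hull_affine_independent by blast

lemma Int_convex_hull_subset:
  fixes V :: "point set"
  assumes "\<not> affine_dependent V" "S \<subseteq> V"
  shows "V \<inter> convex hull S = S"
  using vertex_in_hull[OF assms(1), of _ S] assms(2) hull_mono[OF assms(2)] hull_subset[of S convex]
  by auto

text \<open>A face of \<open>D\<close> cut with a convex subset of \<open>D\<close> is a face of
  that subset, and the faces of a simplex are hulls of subsets of its vertices.\<close>

lemma Int_hull_face:
  fixes V :: "point set"
  assumes "\<not> affine_dependent V" "C face_of D" "convex hull V \<subseteq> D"
  shows "convex hull V \<inter> C = convex hull (V \<inter> C)"
proof
  have "C \<inter> convex hull V face_of D \<inter> convex hull V"
    using assms(2) by (rule face_of_slice) (rule convex_convex_hull)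
  moreover have "D \<inter> convex hull V = convex hull V" using assms(3) by auto
  ultimately obtain c where c: "c \<subseteq> V" "C \<inter> convex hull V = convex hull c"
    using face_of_convex_hull_affine_independent[OF assms(1)] by auto
  have "c \<subseteq> V \<inter> C" using c hull_subset[of c convex] by auto
  then show "convex hull V \<inter> C \<subseteq> convex hull (V \<inter> C)"
    using c(2) hull_mono[of c "V \<inter> C" convex] by auto
  have "convex C" using assms(2) by (rule face_of_imp_convex)
  then show "convex hull (V \<inter> C) \<subseteq> convex hull V \<inter> C"
    by (simp add: hull_minimal hull_mono)
qed

text \<open>Affine dimension is monotone: \<open>F\<close> has dimension \<open>card F - 1\<close>,
  the hull of \<open>S\<close> at most \<open>card S - 1\<close>.\<close>

lemma card_in_hull_le:
  fixes F :: "point set"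
  assumes "\<not> affine_dependent F" "F \<subseteq> convex hull S" "finite S"
  shows "card F \<le> card S"
proof -
  have "aff_dim F \<le> aff_dim S"
    using assms(2) aff_dim_subset[of F "convex hull S"] by (simp add: aff_dim_convex_hull)
  then show ?thesis
    using aff_dim_affine_independent[OF assms(1)] aff_dim_le_card[OF assms(3)] by linarith
qed

lemma in_rel_interior_subhull:
  fixes F :: "point set"
  assumes "\<not> affine_dependent F" "z \<in> convex hull F"
  obtains G where "G \<subseteq> F" "z \<in> rel_interior (convex hull G)"
proof -
  have fin: "finite F" using assms(1) by (rule aff_independent_finite)
  \<comment> \<open>A smallest vertex subset whose hull contains \<open>z\<close>: a point on the
    relative boundary would lie in the hull of a smaller one.\<close>
  define G where "G = (ARG_MIN card G. G \<subseteq> F \<and> z \<in> convex hull G)"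
  have G: "G \<subseteq> F \<and> z \<in> convex hull G"
    unfolding G_def by (rule arg_min_natI[of _ F]) (use assms in auto)
  have min: "card G \<le> card G'" if "G' \<subseteq> F \<and> z \<in> convex hull G'" for G'
    unfolding G_def by (rule arg_min_nat_le) (use that in auto)
  have finG: "finite G" using G fin finite_subset by blast
  have "z \<notin> convex hull (G - {a})" if "a \<in> G" for a
    using min[of "G - {a}"] G finG that card_Diff1_less[of G a] by fastforce
  moreover have "\<not> affine_dependent G" using G assms(1) affine_independent_subset by blast
  ultimately have "z \<in> rel_interior (convex hull G)"
    using rel_boundary_of_convex_hull[of G] G by blast
  with G that show thesis by blast
qed

section \<open>Dyadic segments and newest vertex bisection\<close>

text \<open>Bisection with the marks forgotten: any edge may be cut.\<close>

definition halving :: "point set \<Rightarrow> point set \<Rightarrow> bool" where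
  "halving V W \<longleftrightarrow> (\<exists>e a. e \<subseteq> V \<and> card e = 2 \<and> a \<in> e \<and> W = halve V e a)"

lemma halving_invariants:
  assumes "halving\<^sup>*\<^sup>* V W" "\<not> affine_dependent V"
  shows "\<not> affine_dependent W \<and> card W = card V \<and> convex hull W \<subseteq> convex hull V"
  using assms
proof (induction rule: rtranclp_induct)
  case (step W W')
  then obtain e a where "e \<subseteq> W" "card e = 2" "a \<in> e" "W' = halve W e a"
    by (auto simp: halving_def)
  then show ?case
    using step.IH step.prems affine_independent_halve[of W e a] card_halve[of W e a]
      convex_hull_halve_subset[of W e a] by auto
qed auto

definition dyadic_step :: "point set \<Rightarrow> point set \<Rightarrow> bool" where
  "dyadic_step g h \<longleftrightarrow> (\<exists>a\<in>g. h = halve g g a)"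

lemma affine_independent_card_2:
  fixes g :: "point set"
  shows "card g = 2 \<Longrightarrow> \<not> affine_dependent g"
  by (metis affine_independent_2 card_2_iff)

lemma dyadic_step_halving: "dyadic_step g h \<Longrightarrow> card g = 2 \<Longrightarrow> halving g h \<and> card h = 2"
  using card_halve[of g g] affine_independent_card_2[of g]
  by (fastforce simp: dyadic_step_def halving_def)

lemma dyadic_halving:
  assumes "dyadic_step\<^sup>*\<^sup>* J g" "card J = 2"
  shows "halving\<^sup>*\<^sup>* J g \<and> card g = 2"
  using assms by (induction rule: rtranclp_induct)
    (auto dest: dyadic_step_halving intro: rtranclp.rtrancl_into_rtrancl)

text \<open>A segment has only one bisection. A new edge on \<open>J\<close> contains the new
  midpoint, so the cut edge lies on \<open>J\<close> too, is the whole trace of the simplex there,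
  and \<open>g\<close> is one of its halves.\<close>

lemma dyadic_trace:
  assumes "halving\<^sup>*\<^sup>* V W" "\<not> affine_dependent V" "J \<subseteq> V" "card J = 2"
    and "g \<subseteq> W" "g \<subseteq> convex hull J" "card g = 2"
  shows "dyadic_step\<^sup>*\<^sup>* J g"
  using assms
proof (induction arbitrary: g rule: rtranclp_induct)
  case base
  have "g \<subseteq> J" using Int_convex_hull_subset[of V J] base by auto
  then have "g = J" using base
    by (metis card_subset_eq card.infinite zero_neq_numeral)
  then show ?case by simp
next
  case (step W W')
  let ?C = "convex hull J"
  obtain e a where e: "e \<subseteq> W" "card e = 2" "a \<in> e" and W': "W' = halve W e a"
    using step.hyps(2) by (auto simp: halving_def)
  note W = halving_invariants[OF step.hyps(1) step.prems(1)]
  have face: "?C face_of convex hull V" using face_of_subhull step.prems(1,2) by blast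
  show ?case
  proof (cases "mid e \<in> g")
    case False
    then have "g \<subseteq> W" using step.prems(4) by (auto simp: W' halve_def)
    then show ?thesis using step by blast
  next
    case True
    have sub: "W \<subseteq> convex hull V" using W hull_subset[of W convex] by blast
    have "mid e \<in> ?C" using True step.prems(5) by blast
    then have eW: "e \<subseteq> W \<inter> ?C" and g: "g \<subseteq> halve (W \<inter> ?C) e a"
      using halve_Int_face[OF _ e(1,2,3) face sub] W step.prems(4,5) W' by auto
    have "card (W \<inter> ?C) \<le> 2"
      using card_in_hull_le[of "W \<inter> ?C" J] W affine_independent_subset[of W "W \<inter> ?C"]
        step.prems(3) card_ge_0_finite[of J] by auto
    then have eq: "W \<inter> ?C = e" using eW e(2) W
      by (metis card_seteq finite_Int aff_independent_finite)
    have "card (halve e e a) = 2" using card_halve[of e e a] e affine_independent_card_2 by auto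
    then have "g = halve e e a" using g eq step.prems(6)
      by (metis card_subset_eq card.infinite zero_neq_numeral)
    moreover have "dyadic_step\<^sup>*\<^sup>* J e" using step.IH[of e] step.prems eW e by auto
    moreover have "dyadic_step e (halve e e a)" using e(3) by (auto simp: dyadic_step_def)
    ultimately show ?thesis by (metis rtranclp.rtrancl_into_rtrancl)
  qed
qed

text \<open>Descend from \<open>J\<close> towards \<open>g\<close> and \<open>e\<close> together. If
  the paths part, \<open>mid e\<close> is the midpoint of \<open>J\<close>, which is an endpoint of
  the half containing \<open>e\<close>; this is impossible.\<close>

lemma dyadic_laminar:
  assumes "dyadic_step\<^sup>*\<^sup>* J g" "dyadic_step\<^sup>*\<^sup>* J e" "card J = 2"
    and z: "mid e \<in> rel_interior (convex hull g)"
  shows "e \<subseteq> convex hull g"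
  using assms(1-3)
proof (induction rule: converse_rtranclp_induct)
  case base
  then show ?case
    using halving_invariants dyadic_halving affine_independent_card_2 hull_subset[of e convex] by blast
next
  case (step J J')
  obtain a where a: "a \<in> J" "J' = halve J J a" using step.hyps(1) by (auto simp: dyadic_step_def)
  have J': "card J' = 2" "\<not> affine_dependent J'"
    using dyadic_step_halving step affine_independent_card_2 by auto
  have g: "convex hull g \<subseteq> convex hull J'" "card g = 2"
    using halving_invariants dyadic_halving[OF step.hyps(2)] J' by auto
  have e: "card e = 2" using dyadic_halving step.prems by blast
  from step.prems(1) show ?case
  proof (cases rule: converse_rtranclpE)
    \<comment> \<open>Now \<open>e\<close> is \<open>J\<close>: its midpoint is an endpoint of the
      half containing \<open>g\<close>, hence not relatively interior to \<open>g\<close>.\<close>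
    case base
    then have "{mid e} \<subseteq> J'" using a by (auto simp: halve_def)
    then have "convex hull {mid e} face_of convex hull J'" using face_of_subhull J' by blast
    moreover have "convex hull {mid e} \<inter> rel_interior (convex hull g) \<noteq> {}" using z by auto
    ultimately have "convex hull g \<subseteq> convex hull {mid e}" using subset_of_face_of g by blast
    then have "g \<subseteq> {mid e}" using hull_subset[of g convex] by auto
    then show ?thesis using g(2) card_mono[of "{mid e}" g] by auto
  next
    case (step J'')
    then obtain b where b: "b \<in> J" "J'' = halve J J b" by (auto simp: dyadic_step_def)
    show ?thesis
    proof (cases "a = b")
      case True
      then show ?thesis using a b step.IH step J' \<open>dyadic_step\<^sup>*\<^sup>* J'' e\<close> by auto
    next
      case False
      have J'': "card J'' = 2" "\<not> affine_dependent J''"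
        using dyadic_step_halving step(1) \<open>card J = 2\<close> affine_independent_card_2 by auto
      have eJ'': "convex hull e \<subseteq> convex hull J''"
        using halving_invariants dyadic_halving[OF step(2)] J'' by auto
      have "mid e \<in> convex hull J' \<inter> convex hull J''"
        using z rel_interior_subset g(1) mid_in_convex_hull[OF e] eJ'' by blast
      also have "\<dots> = {mid J}"
        using convex_hull_halves_Int[of J J a b] a b False \<open>card J = 2\<close> affine_independent_card_2
        by auto
      finally have "mid e \<in> convex hull {mid J}" by simp
      moreover have "convex hull {mid J} face_of convex hull J''"
        using b by (intro face_of_subhull J'') (simp add: halve_def)
      ultimately have "e \<subseteq> convex hull {mid J}"
        using face_of_edgeD e eJ'' hull_subset[of e convex] by blast
      then show ?thesis using e card_mono[of "{mid J}" e] by auto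
    qed
  qed
qed

section \<open>Newest vertex bisection of a marked triangle\<close>

definition tri_step :: "point set \<times> point set \<Rightarrow> point set \<times> point set \<Rightarrow> bool" where
  "tri_step p q \<longleftrightarrow> (\<exists>a\<in>snd p. fst q = halve (fst p) (snd p) a \<and> snd q = fst q - {mid (snd p)})"

definition marked_tri :: "point set \<times> point set \<Rightarrow> bool" where
  "marked_tri p \<longleftrightarrow> \<not> affine_dependent (fst p) \<and> card (fst p) = 3 \<and> snd p \<subseteq> fst p \<and> card (snd p) = 2"

lemma marked_tri_step:
  assumes "tri_step p q" "marked_tri p"
  shows "marked_tri q" "halving (fst p) (fst q)"
proof -
  obtain a where a: "a \<in> snd p" "fst q = halve (fst p) (snd p) a" "snd q = fst q - {mid (snd p)}"
    using assms(1) by (auto simp: tri_step_def)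
  have c: "card (fst q) = 3" using card_halve a assms(2) by (simp add: marked_tri_def)
  have "mid (snd p) \<in> fst q" using a by (simp add: halve_def)
  then have "card (snd q) = 2" using c a(3) card_Diff_singleton[of "mid (snd p)" "fst q"] by simp
  then show "marked_tri q" using c a assms(2) affine_independent_halve
    by (auto simp: marked_tri_def)
  show "halving (fst p) (fst q)" using a assms(2) by (auto simp: halving_def marked_tri_def)
qed

lemma marked_tri_steps:
  assumes "tri_step\<^sup>*\<^sup>* p q" "marked_tri p"
  shows "marked_tri q \<and> halving\<^sup>*\<^sup>* (fst p) (fst q)"
  using assms by (induction rule: rtranclp_induct)
    (auto dest: marked_tri_step intro: rtranclp.rtrancl_into_rtrancl)

definition tri_edge :: "point set \<times> point set \<Rightarrow> point set \<Rightarrow> bool" where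
  "tri_edge p g \<longleftrightarrow> (\<exists>q. tri_step\<^sup>*\<^sup>* p q \<and> g \<subseteq> fst q \<and> card g = 2)"

text \<open>
  An unmarked edge of a triangle is the marked edge of one of the triangle's two children.
\<close>

lemma tri_edge_halve:
  assumes "marked_tri p" "tri_edge p g" "a \<in> g"
  shows "tri_edge p (halve g g a)"
proof -
  obtain q where q: "tri_step\<^sup>*\<^sup>* p q" "g \<subseteq> fst q" "card g = 2"
    using assms(2) by (auto simp: tri_edge_def)
  have mark: "tri_edge p (halve g g a)" if r: "tri_step\<^sup>*\<^sup>* p r" "snd r = g" for r
  proof -
    let ?W = "halve (fst r) g a"
    have tr: "marked_tri r" using marked_tri_steps[OF r(1) assms(1)] by simp
    have "tri_step r (?W, ?W - {mid g})" using r(2) assms(3) by (auto simp: tri_step_def)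
    then have "tri_step\<^sup>*\<^sup>* p (?W, ?W - {mid g})" using r(1) by simp
    moreover have "halve g g a \<subseteq> ?W" using tr r(2) by (auto simp: halve_def marked_tri_def)
    moreover have "card (halve g g a) = 2"
      using card_halve[of g g a] q(3) assms(3) affine_independent_card_2 by auto
    ultimately show ?thesis unfolding tri_edge_def by fastforce
  qed
  have tq: "marked_tri q" using marked_tri_steps[OF q(1) assms(1)] by simp
  show ?thesis
  proof (cases "snd q = g")
    case True
    with q mark show ?thesis by blast
  next
    case False
    let ?n = "snd q"
    have fin: "finite (fst q)" using tq by (simp add: marked_tri_def aff_independent_finite)
    \<comment> \<open>Two disjoint edges would need four vertices, so \<open>g\<close> shares a
      vertex with the marked edge.\<close>
    have "card (?n \<union> g) \<le> 3" using tq q(2) fin card_mono[of "fst q" "?n \<union> g"]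
      by (auto simp: marked_tri_def)
    moreover have fin2: "finite ?n" "finite g" using tq q fin by (auto simp: marked_tri_def dest: finite_subset)
    ultimately have "?n \<inter> g \<noteq> {}" using card_Un_disjoint[of ?n g] tq q(3)
      by (auto simp: marked_tri_def)
    then obtain x where x: "x \<in> ?n" "x \<in> g" by blast
    obtain y where y: "y \<noteq> x" "?n = {x, y}" using pair_at[of ?n x] tq x by (auto simp: marked_tri_def)
    obtain c where c: "c \<noteq> x" "g = {x, c}" using pair_at[of g x] q(3) x by auto
    have "c \<noteq> y" using False y c by auto
    then have "fst q = {x, y, c}" using tq q(2) y c fin
      by (intro card_subset_eq[symmetric]) (auto simp: marked_tri_def)
    moreover have "mid ?n \<notin> fst q" using mid_notin[of "fst q" ?n] tq by (auto simp: marked_tri_def)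
    ultimately have "halve (fst q) ?n x - {mid ?n} = g" using y c \<open>c \<noteq> y\<close> by (auto simp: halve_def)
    then have "tri_step q (halve (fst q) ?n x, g)" using x by (auto simp: tri_step_def)
    then show ?thesis using mark q(1) by (metis rtranclp.rtrancl_into_rtrancl snd_conv)
  qed
qed

text \<open>Descend from \<open>p\<close> towards \<open>q\<close> and \<open>r\<close> together. At
  the node \<open>q\<close> the hull of \<open>G\<close> is a face; at the node \<open>r\<close>, or
  where the paths part, \<open>e\<close> and \<open>G\<close> both lie on one segment and the claim
  reduces to \<open>dyadic_laminar\<close>.\<close>

lemma tri_laminar:
  assumes "tri_step\<^sup>*\<^sup>* p q" "G \<subseteq> fst q" "2 \<le> card G" "tri_step\<^sup>*\<^sup>* p r" "e \<subseteq> fst r" "card e = 2"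
    and z: "mid e \<in> rel_interior (convex hull G)" and "marked_tri p"
  shows "e \<subseteq> convex hull G"
  using assms(1-6) \<open>marked_tri p\<close>
proof (induction rule: converse_rtranclp_induct)
  case base
  then have "convex hull G face_of convex hull (fst q)"
    using face_of_subhull by (auto simp: marked_tri_def)
  moreover have "e \<subseteq> convex hull (fst q)"
    using halving_invariants marked_tri_steps[OF base(3)] base(4,6) hull_subset[of "fst r" convex]
    by (fastforce simp: marked_tri_def)
  ultimately show ?case using face_of_edgeD z rel_interior_subset base(5) by blast
next
  case (step p p')
  have G: "convex hull G \<subseteq> convex hull (fst q)" using step.prems(1) by (rule hull_mono)
  have p: "\<not> affine_dependent (fst p)" "snd p \<subseteq> fst p" "card (snd p) = 2" "card (fst p) = 3"
    using step.prems by (auto simp: marked_tri_def)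
  have halv: "halving\<^sup>*\<^sup>* (fst p) (fst q)"
    using marked_tri_steps[of p q] step by (meson converse_rtranclp_into_rtranclp)
  \<comment> \<open>The one-dimensional case: \<open>G\<close> lies on the segment \<open>J\<close>,
    has exactly two points, and is a dyadic part of \<open>J\<close> as \<open>e\<close> is.\<close>
  have within: ?case if J: "J \<subseteq> V" "card J = 2" "convex hull G \<subseteq> convex hull J"
    "dyadic_step\<^sup>*\<^sup>* J e" and V: "\<not> affine_dependent V" "halving\<^sup>*\<^sup>* V (fst q)" for J V
  proof -
    have GJ: "G \<subseteq> convex hull J" using J(3) hull_subset[of G convex] by blast
    have "\<not> affine_dependent G" using halving_invariants[OF V(2,1)] step.prems(1)
      affine_independent_subset by blast
    then have "card G \<le> card J"
      using card_in_hull_le[of G J] GJ J(2) card_ge_0_finite[of J] by auto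
    then have "card G = 2" using step.prems(2) J(2) by simp
    then have "dyadic_step\<^sup>*\<^sup>* J G" using dyadic_trace[OF V(2,1)] J(1,2) GJ step.prems(1) by blast
    then show ?thesis using dyadic_laminar J(2,4) z by blast
  qed
  obtain a where a: "a \<in> snd p" "fst p' = halve (fst p) (snd p) a" "snd p' = fst p' - {mid (snd p)}"
    using step.hyps(1) by (auto simp: tri_step_def)
  have p': "marked_tri p'" using marked_tri_step step by blast
  have G': "convex hull G \<subseteq> convex hull (fst p')"
    using G halving_invariants marked_tri_steps[OF step.hyps(2) p'] p'
    by (fastforce simp: marked_tri_def)
  from step.prems(3) show ?case
  proof (cases rule: converse_rtranclpE)
    case base
    \<comment> \<open>Now \<open>e\<close> is an edge of the root \<open>p\<close>; as a face it
      meets the relative interior of \<open>G\<close> and so contains \<open>G\<close>.\<close>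
    have "convex hull e face_of convex hull (fst p)"
      using face_of_subhull p(1) step.prems(4) base by blast
    moreover have "convex hull G \<subseteq> convex hull (fst p)"
      using G halving_invariants[OF halv p(1)] by blast
    moreover have "convex hull e \<inter> rel_interior (convex hull G) \<noteq> {}"
      using z mid_in_convex_hull[OF step.prems(5)] by blast
    ultimately have "convex hull G \<subseteq> convex hull e" by (rule subset_of_face_of)
    then show ?thesis using within[of e "fst p"] step.prems(4,5) base p(1) halv by auto
  next
    case (step p'')
    then obtain b where b: "b \<in> snd p" "fst p'' = halve (fst p) (snd p) b"
      "snd p'' = fst p'' - {mid (snd p)}"
      by (auto simp: tri_step_def)
    have p'': "marked_tri p''" using marked_tri_step step \<open>marked_tri p\<close> by blast
    show ?thesis
    proof (cases "a = b")
      case True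
      then have "p'' = p'" using a b by (simp add: prod_eq_iff)
      then show ?thesis using step.IH step p' \<open>2 \<le> card G\<close> \<open>G \<subseteq> fst q\<close> \<open>e \<subseteq> fst r\<close> \<open>card e = 2\<close> by blast
    next
      case False
      \<comment> \<open>The cut from the new midpoint to the opposite vertex, which is the common
        edge of the two children.\<close>
      let ?J = "insert (mid (snd p)) (fst p - snd p)"
      have J: "?J \<subseteq> fst p'" "?J \<subseteq> fst p''" using a b by (auto simp: halve_def)
      have "card (fst p - snd p) = 1" using p card_Diff_subset[of "snd p" "fst p"] card_ge_0_finite[of "snd p"] by auto
      then have cJ: "card ?J = 2" using mid_notin p card_ge_0_finite[of "fst p - snd p"] by auto
      have halv'': "halving\<^sup>*\<^sup>* (fst p'') (fst r)" using marked_tri_steps step(2) p'' by blast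
      have e: "convex hull e \<subseteq> convex hull (fst p'')"
        using halving_invariants[OF halv''] p'' hull_mono[OF \<open>e \<subseteq> fst r\<close>, of convex]
        by (auto simp: marked_tri_def)
      have zJ: "mid e \<in> convex hull ?J"
      proof -
        have "mid e \<in> convex hull (fst p')" using z rel_interior_subset G' by blast
        moreover have "mid e \<in> convex hull (fst p'')"
          using mid_in_convex_hull[OF \<open>card e = 2\<close>] e by blast
        ultimately show ?thesis
          using convex_hull_halves_Int[OF p(1,2,3) a(1) b(1) False] a(2) b(2) by auto
      qed
      have "convex hull ?J face_of convex hull (fst p'')"
        using face_of_subhull p'' J by (auto simp: marked_tri_def)
      then have "e \<subseteq> convex hull ?J"
        using face_of_edgeD \<open>card e = 2\<close> zJ e hull_subset[of e convex] by blast
      then have dy: "dyadic_step\<^sup>*\<^sup>* ?J e"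
        using dyadic_trace[OF halv''] p'' J cJ \<open>e \<subseteq> fst r\<close> \<open>card e = 2\<close> by (auto simp: marked_tri_def)
      \<comment> \<open>In the other child this face meets the relative interior of \<open>G\<close>
        and so contains \<open>G\<close>.\<close>
      have "convex hull ?J face_of convex hull (fst p')"
        using face_of_subhull p' J by (auto simp: marked_tri_def)
      then have "convex hull G \<subseteq> convex hull ?J"
        using subset_of_face_of G' zJ z by blast
      with dy show ?thesis
        using within[of ?J "fst p'"] cJ J p' marked_tri_steps[OF \<open>tri_step\<^sup>*\<^sup>* p' q\<close> p']
        by (auto simp: marked_tri_def)
    qed
  qed
qed

section \<open>Descendants of a marked tetrahedron\<close>

text \<open>The invariant carried through bisection: nondegeneracy, and a marking in which every
  face on the refinement edge is marked by it.\<close>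

definition well_marked :: "marked_tet \<Rightarrow> bool" where
  "well_marked K \<longleftrightarrow> card (verts K) = 4 \<and> \<not> affine_dependent (verts K) \<and> redge K \<in> edges (verts K) \<and>
     (\<forall>F\<in>faces (verts K). mark K F \<in> edges F \<and> (redge K \<subseteq> F \<longrightarrow> mark K F = redge K))"

lemma is_marked_tet_well_marked: "is_marked_tet K \<Longrightarrow> well_marked K"
  by (auto simp: is_marked_tet_def well_marked_def)

lemma verts_child: "verts (child K a) = halve (verts K) (redge K) a"
  by (simp add: child_def Let_def inherited_face_def halve_def)

lemma redge_child: "redge (child K a) = mark K (inherited_face K a)"
  by (simp add: child_def Let_def)

lemma mark_child:
  assumes "F \<in> faces (verts (child K a))"
  shows "mark (child K a) F = (if mid (redge K) \<notin> F then mark K F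
           else if a \<in> F then F - {mid (redge K)} else new_face_mark K)"
  using assms by (simp add: child_def Let_def)

lemma well_markedE:
  assumes "well_marked K" "a \<in> redge K"
  obtains b c d where "redge K = {a, b}" "verts K = {a, b, c, d}" "distinct [a, b, c, d]"
proof -
  have r: "redge K \<subseteq> verts K" "card (redge K) = 2" "card (verts K) = 4"
    using assms(1) by (auto simp: well_marked_def edges_def)
  obtain b where b: "b \<noteq> a" "redge K = {a, b}" using pair_at r(2) assms(2) by metis
  have "card (verts K - redge K) = 2" using r card_Diff_subset[of "redge K" "verts K"]
      card_ge_0_finite[of "redge K"] by simp
  then obtain c d where cd: "c \<noteq> d" "verts K - redge K = {c, d}" by (meson card_2_iff)
  then have "verts K = {a, b, c, d}" using r(1) b by auto
  moreover have "distinct [a, b, c, d]" using b cd by auto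
  ultimately show thesis using that b by blast
qed

lemma inherited_face_eq:
  assumes "redge K = {a, b}" "verts K = {a, b, c, d}" "distinct [a, b, c, d]"
  shows "inherited_face K a = {a, c, d}" "inherited_face K b = {b, c, d}"
  using assms by (auto simp: inherited_face_def)

lemma not_coplanar:
  fixes V :: "point set"
  assumes "\<not> affine_dependent V" "card V = 4" "V \<subseteq> U"
  shows "\<not> coplanar U"
proof
  assume "coplanar U"
  then obtain u v w where "U \<subseteq> affine hull {u, v, w}" by (auto simp: coplanar_def)
  then have "aff_dim V \<le> aff_dim {u, v, w}"
    using assms(3) aff_dim_subset[of V "affine hull {u, v, w}"] by (simp add: aff_dim_affine_hull)
  moreover have "aff_dim {u, v, w} \<le> int (card {u, v, w}) - 1" by (rule aff_dim_le_card) simp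
  moreover have "card {u, v, w} \<le> 3" by (simp add: card_insert_if)
  ultimately show False using aff_dim_affine_independent[OF assms(1)] assms(2) by simp
qed

lemma edges_triple: "distinct [x, y, z] \<Longrightarrow> edges {x, y, z} = {{x, y}, {x, z}, {y, z}}"
proof -
  assume d: "distinct [x, y, z]"
  have "g \<in> {{x, y}, {x, z}, {y, z}}" if g: "g \<subseteq> {x, y, z}" "card g = 2" for g
  proof -
    obtain p q where "p \<noteq> q" "g = {p, q}" using g(2) unfolding card_2_iff by blast
    moreover from this have "p \<in> {x, y, z}" "q \<in> {x, y, z}" using g by simp_all
    ultimately show ?thesis by (elim insertE emptyE) (simp_all add: doubleton_eq_iff)
  qed
  then show ?thesis using d by (auto simp: edges_def)
qed

text \<open>The refinement faces put \<open>a\<close> and \<open>b\<close> among the endpoints of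
  marks. Coplanarity keeps one of \<open>c\<close>, \<open>d\<close> out of all marks, so both
  nonrefinement marks end at the other one.\<close>

lemma type_P_marks:
  assumes K: "well_marked K" "type_P K"
    and V: "redge K = {a, b}" "verts K = {a, b, c, d}" "distinct [a, b, c, d]"
  shows "\<exists>w\<in>{c, d}. mark K {a, c, d} = {a, w} \<and> mark K {b, c, d} = {b, w}"
proof -
  define U where "U = (\<Union>F\<in>faces (verts K). mark K F)"
  have f: "{a, b, c} \<in> faces (verts K)" "{a, c, d} \<in> faces (verts K)" "{b, c, d} \<in> faces (verts K)"
    using V by (auto simp: faces_def)
  have "mark K {a, b, c} = {a, b}" using K(1) f(1) V(1) by (auto simp: well_marked_def)
  then have "{a, b} \<subseteq> U" using f(1) by (auto simp: U_def)
  moreover have "\<not> verts K \<subseteq> U"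
    using not_coplanar[of "verts K" U] K by (auto simp: well_marked_def type_P_def U_def)
  ultimately have "\<not> {c, d} \<subseteq> U" using V(2) by auto
  moreover have "mark K {a, c, d} \<subseteq> U" "mark K {b, c, d} \<subseteq> U" using f by (auto simp: U_def)
  moreover have "mark K {a, c, d} \<in> edges {a, c, d}" "mark K {b, c, d} \<in> edges {b, c, d}"
    using K(1) f(2,3) unfolding well_marked_def by blast+
  then have "mark K {a, c, d} \<in> {{a, c}, {a, d}, {c, d}}" "mark K {b, c, d} \<in> {{b, c}, {b, d}, {c, d}}"
    using V(3) by (simp_all add: edges_triple)
  ultimately show ?thesis by auto
qed

text \<open>In the flagged case \<open>type_P_marks\<close> provides the vertex and makes the
  solution of the \<open>THE\<close> unique. The second alternative also records the mark of the
  inherited face, which is the refinement edge of the child at \<open>a\<close>.\<close>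

lemma new_face_mark_eq:
  assumes K: "well_marked K"
    and V: "redge K = {a, b}" "verts K = {a, b, c, d}" "distinct [a, b, c, d]"
  shows "new_face_mark K = {c, d} \<or>
    (\<exists>w\<in>{c, d}. new_face_mark K = {mid (redge K), w} \<and> mark K {a, c, d} = {a, w})"
proof (cases "type_Pf K")
  case True
  then obtain w where w: "w \<in> {c, d}" "mark K {a, c, d} = {a, w}" "mark K {b, c, d} = {b, w}"
    using type_P_marks[OF K _ V] by (auto simp: type_Pf_def)
  have "(THE w. w \<in> verts K - redge K \<and> (\<forall>a\<in>redge K. w \<in> mark K (inherited_face K a))) = w"
    using w V inherited_face_eq[OF V] by (intro the_equality) auto
  then show ?thesis using True w by (auto simp: new_face_mark_def)
next
  case False
  then show ?thesis using V by (auto simp: new_face_mark_def)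
qed

text \<open>The child's refinement edge lies on the inherited face. A cut face can contain it only
  as the edge opposite the midpoint, which is its mark. The new face can contain it only as
  \<open>{c, d}\<close>; if that face is marked by an edge through the midpoint, the refinement edge
  runs through \<open>a\<close> and is not on it.\<close>

lemma well_marked_child:
  assumes K: "well_marked K" and a: "a \<in> redge K"
  shows "well_marked (child K a)"
proof -
  obtain b c d where V: "redge K = {a, b}" "verts K = {a, b, c, d}" "distinct [a, b, c, d]"
    using well_markedE[OF K a] by metis
  let ?m = "mid (redge K)" and ?C = "child K a"
  have r: "\<not> affine_dependent (verts K)" "redge K \<subseteq> verts K" "card (redge K) = 2" "card (verts K) = 4"
    using K by (auto simp: well_marked_def edges_def)
  have m: "?m \<notin> verts K" using mid_notin r by blast
  have inh: "inherited_face K a = {a, c, d}" "{a, c, d} \<in> faces (verts K)"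
    using inherited_face_eq[OF V] V by (auto simp: faces_def)
  have vC: "verts ?C = {?m, a, c, d}" using V by (auto simp: verts_child halve_def)
  have rC: "redge ?C \<in> edges {a, c, d}" using inh K by (auto simp: redge_child well_marked_def)
  have "mark ?C F \<in> edges F \<and> (redge ?C \<subseteq> F \<longrightarrow> mark ?C F = redge ?C)"
    if F: "F \<in> faces (verts ?C)" for F
  proof -
    consider "?m \<notin> F" | "?m \<in> F" "a \<in> F" | "?m \<in> F" "a \<notin> F" by blast
    then show ?thesis
    proof cases
      case 1
      then have "F \<subseteq> {a, c, d}" "card F = 3" using F vC by (auto simp: faces_def)
      then have "F = {a, c, d}" using V(3) by (intro card_subset_eq) auto
      then show ?thesis using mark_child[OF F] 1 inh K by (auto simp: redge_child well_marked_def)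
    next
      case 2
      then have mk: "mark ?C F = F - {?m}" using mark_child[OF F] by simp
      have c: "card (F - {?m}) = 2" using F 2 by (simp add: faces_def)
      have "redge ?C = F - {?m}" if "redge ?C \<subseteq> F"
        using that rC m V(2) c card_ge_0_finite[of "F - {?m}"]
        by (intro card_subset_eq) (auto simp: edges_def)
      then show ?thesis using mk c by (auto simp: edges_def)
    next
      case 3
      then have "F \<subseteq> {?m, c, d}" "card F = 3" using F vC by (auto simp: faces_def)
      then have Feq: "F = {?m, c, d}" using V m by (intro card_subset_eq) auto
      have mk: "mark ?C F = new_face_mark K" using mark_child[OF F] 3 by simp
      have sub: "redge ?C = {c, d}" if "redge ?C \<subseteq> F"
        using that rC m V edges_triple[of a c d] Feq by auto
      show ?thesis
        using new_face_mark_eq[OF K V]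
      proof
        assume "new_face_mark K = {c, d}"
        then show ?thesis using mk sub V Feq by (auto simp: edges_def)
      next
        assume "\<exists>w\<in>{c, d}. new_face_mark K = {?m, w} \<and> mark K {a, c, d} = {a, w}"
        then obtain w where w: "w \<in> {c, d}" "new_face_mark K = {?m, w}" "redge ?C = {a, w}"
          using inh by (auto simp: redge_child)
        have "?m \<noteq> w" using w m V by auto
        moreover have "\<not> redge ?C \<subseteq> F" using w 3 by auto
        ultimately show ?thesis using mk w Feq by (auto simp: edges_def)
      qed
    qed
  qed
  moreover have "card (verts ?C) = 4" "\<not> affine_dependent (verts ?C)"
    using card_halve[OF r(1-3) a] affine_independent_halve[OF r(1-3) a] r(4)
    by (auto simp: verts_child)
  moreover have "redge ?C \<in> edges (verts ?C)" using rC vC by (auto simp: edges_def)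
  ultimately show ?thesis by (auto simp: well_marked_def)
qed

section \<open>Descent and its trace on a face\<close>

definition child_rel :: "marked_tet \<Rightarrow> marked_tet \<Rightarrow> bool" where
  "child_rel K C \<longleftrightarrow> C \<in> children K"

lemma child_rel_halving:
  assumes "child_rel K C" "well_marked K"
  shows "well_marked C" "halving (verts K) (verts C)"
proof -
  obtain a where a: "a \<in> redge K" "C = child K a"
    using assms(1) by (auto simp: child_rel_def children_def)
  then show "well_marked C" using assms(2) well_marked_child by simp
  show "halving (verts K) (verts C)"
    unfolding halving_def using a assms(2)
    by (intro exI[of _ "redge K"] exI[of _ a]) (simp add: verts_child well_marked_def edges_def)
qed

lemma descendant_halving:
  assumes "child_rel\<^sup>*\<^sup>* A K" "well_marked A"
  shows "well_marked K \<and> halving\<^sup>*\<^sup>* (verts A) (verts K)"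
  using assms
proof (induction rule: rtranclp_induct)
  case (step K C)
  then have "well_marked C" "halving (verts K) (verts C)" using child_rel_halving by blast+
  then show ?case using step by (meson rtranclp.rtrancl_into_rtrancl)
qed simp

lemma descendant_solid_subset:
  assumes "child_rel\<^sup>*\<^sup>* A K" "well_marked A"
  shows "solid K \<subseteq> solid A"
  using descendant_halving[OF assms] halving_invariants[of "verts A" "verts K"] assms(2)
  unfolding well_marked_def by blast

lemma descendant_vertex:
  assumes "child_rel\<^sup>*\<^sup>* A K" "well_marked A" "v \<in> verts A" "v \<in> solid K"
  shows "v \<in> verts K"
  using vertex_in_hull[OF _ assms(3,4) descendant_solid_subset[OF assms(1,2)]] assms(2)
  unfolding well_marked_def by blast

lemma marked_tri_face:
  assumes "well_marked A" "S \<subseteq> verts A" "card S = 3"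
  shows "marked_tri (S, mark A S)"
proof -
  have "mark A S \<in> edges S" using assms unfolding well_marked_def faces_def by blast
  moreover have "\<not> affine_dependent S"
    using assms(1,2) affine_independent_subset unfolding well_marked_def by blast
  ultimately show ?thesis using assms(3) by (simp add: marked_tri_def edges_def)
qed

text \<open>
  A descendant that meets \<open>S\<close> in an edge only may halve that edge although no triangle on its side
  has it as marked edge; therefore the edges are tracked separately from the triangles.
\<close>

lemma face_trace:
  assumes "child_rel\<^sup>*\<^sup>* A K" "well_marked A" "S \<subseteq> verts A" "card S = 3"
  shows "(card (verts K \<inter> convex hull S) = 3 \<longrightarrow>
           tri_step\<^sup>*\<^sup>* (S, mark A S) (verts K \<inter> convex hull S, mark K (verts K \<inter> convex hull S))) \<and>
    (\<forall>g. g \<subseteq> verts K \<inter> convex hull S \<longrightarrow> card g = 2 \<longrightarrow> tri_edge (S, mark A S) g)"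
  using assms
proof (induction rule: rtranclp_induct)
  case base
  have "verts A \<inter> convex hull S = S"
    using Int_convex_hull_subset base by (auto simp: well_marked_def)
  moreover have "tri_edge (S, mark A S) g" if "g \<subseteq> S" "card g = 2" for g
    using that unfolding tri_edge_def by (intro exI[of _ "(S, mark A S)"]) simp
  ultimately show ?case by simp
next
  case (step K C)
  note IH = step.IH[OF step.prems]
  let ?H = "convex hull S" and ?e = "redge K" and ?p = "(S, mark A S)"
  let ?m = "mid ?e" and ?F = "verts K \<inter> ?H" and ?F' = "verts C \<inter> ?H"
  have K: "well_marked K" and sub: "verts K \<subseteq> solid A"
    using descendant_halving descendant_solid_subset step.hyps(1) step.prems(1)
      hull_subset[of "verts K" convex] by blast+
  then have r: "\<not> affine_dependent (verts K)" "?e \<subseteq> verts K" "card ?e = 2"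
    by (auto simp: well_marked_def edges_def)
  obtain a where a: "a \<in> ?e" and C: "C = child K a"
    using step.hyps(2) by (auto simp: child_rel_def children_def)
  have face: "?H face_of solid A" using face_of_subhull step.prems by (auto simp: well_marked_def)
  have indF: "\<not> affine_dependent ?F" using affine_independent_subset r(1) by blast
  have fin: "finite (verts K)" using r(1) by (rule aff_independent_finite)
  have cF: "card ?F \<le> 3"
    using card_in_hull_le[OF indF, of S] step.prems(3) card_ge_0_finite[of S] by auto
  have m: "?m \<notin> verts K" using mid_notin r by blast
  note F' = halve_Int_face[OF r a face sub]
  have tri: "marked_tri ?p" using marked_tri_face step.prems by blast
  show ?case
  proof (cases "?m \<in> ?H")
    case False
    then have F'eq: "?F' = ?F - (?e - {a})" using F' by (simp add: C verts_child)
    have "tri_step\<^sup>*\<^sup>* ?p (?F', mark C ?F')" if c: "card ?F' = 3"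
    proof -
      \<comment> \<open>The trace has at most three vertices, so none has been lost: the face is
        inherited and keeps its mark.\<close>
      have eq: "?F' = ?F" using F'eq c cF fin by (intro card_seteq) auto
      have "?F' \<in> faces (verts C)" using c by (auto simp: faces_def)
      then have "mark C ?F' = mark K ?F'" using mark_child[of ?F' K a] False by (auto simp: C)
      then show ?thesis using IH c eq by simp
    qed
    moreover have "?F' \<subseteq> ?F" using F'eq by auto
    ultimately show ?thesis using IH by (meson order_trans)
  next
    case True
    then have F'eq: "?F' = halve ?F ?e a" and eF: "?e \<subseteq> ?F" using F' by (auto simp: C verts_child)
    have c': "card ?F' = card ?F" using card_halve[OF indF eF r(3) a] F'eq by simp
    have big: "tri_step\<^sup>*\<^sup>* ?p (?F', mark C ?F')" if c: "card ?F' = 3"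
    proof -
      \<comment> \<open>The triangle contains the refinement edge, so it is marked by it; the cut
        face is marked opposite the midpoint. This is exactly one \<open>tri_step\<close>.\<close>
      have "?F \<in> faces (verts K)" "?F' \<in> faces (verts C)" using c c' by (auto simp: faces_def)
      then have "mark K ?F = ?e" "mark C ?F' = ?F' - {?m}"
        using K eF mark_child[of ?F' K a] F'eq a
        by (auto simp: well_marked_def C halve_def)
      then have "tri_step (?F, mark K ?F) (?F', mark C ?F')"
        using F'eq a by (auto simp: tri_step_def)
      then show ?thesis using IH c c' by (metis rtranclp.rtrancl_into_rtrancl)
    qed
    moreover have "tri_edge ?p g" if g: "g \<subseteq> ?F'" "card g = 2" for g
    proof (cases "card ?F' = 3")
      case True
      then show ?thesis using big g unfolding tri_edge_def by (metis fst_conv)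
    next
      case False
      \<comment> \<open>The trace is now just the refinement edge; its halves stay in the tree
        because tree edges are closed under halving.\<close>
      have "card ?e \<le> card ?F" using eF fin by (intro card_mono) auto
      then have "card ?F = 2" using False c' cF r(3) by simp
      then have "?F = ?e" "g = ?F'" using eF g r(3) fin c'
        by (metis card_subset_eq finite_Int, metis card_subset_eq card.infinite zero_neq_numeral)
      then show ?thesis using tri_edge_halve[OF tri, of ?e a] IH F'eq a r(3) by simp
    qed
    ultimately show ?thesis by blast
  qed
qed

section \<open>Separated elements of a mesh\<close>

text \<open>The empty \<open>S\<close> covers disjoint solids. Marks are compared only on a common
  triangle, since a segment has just one bisection.\<close>

definition meets_properly :: "marked_tet \<Rightarrow> marked_tet \<Rightarrow> bool" where
  "meets_properly A A' \<longleftrightarrow> (\<exists>S. S \<subseteq> verts A \<inter> verts A' \<and> card S \<le> 3 \<and>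
     solid A \<inter> solid A' = convex hull S \<and> (card S = 3 \<longrightarrow> mark A S = mark A' S))"

text \<open>Intermediate meshes may fail to be conforming, so contact is controlled at the level of
  ancestors; this form survives every further bisection.\<close>

definition separated :: "marked_tet \<Rightarrow> marked_tet \<Rightarrow> bool" where
  "separated K K' \<longleftrightarrow> (\<exists>A A'. well_marked A \<and> well_marked A' \<and>
     child_rel\<^sup>*\<^sup>* A K \<and> child_rel\<^sup>*\<^sup>* A' K' \<and> meets_properly A A')"

lemma separated_descendants:
  assumes "separated K K'" "child_rel\<^sup>*\<^sup>* K C" "child_rel\<^sup>*\<^sup>* K' C'"
  shows "separated C C'"
  using assms unfolding separated_def by (meson rtranclp_trans)

text \<open>The siblings themselves serve as ancestors: they meet in the new face, whose mark
  depends on the parent alone.\<close>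

lemma separated_siblings:
  assumes K: "well_marked K" and ab: "a \<in> redge K" "b \<in> redge K" "a \<noteq> b"
  shows "separated (child K a) (child K b)"
proof -
  let ?m = "mid (redge K)" and ?S = "insert (mid (redge K)) (verts K - redge K)"
  have r: "\<not> affine_dependent (verts K)" "redge K \<subseteq> verts K" "card (redge K) = 2" "card (verts K) = 4"
    using K by (auto simp: well_marked_def edges_def)
  have fin: "finite (verts K)" using r(1) by (rule aff_independent_finite)
  have sub: "?S \<subseteq> verts (child K a) \<inter> verts (child K b)" by (auto simp: verts_child halve_def)
  have "card (verts K - redge K) = 2"
    using r fin card_Diff_subset[of "redge K" "verts K"] finite_subset[of "redge K" "verts K"] by simp
  then have card: "card ?S = 3" using mid_notin[OF r(1-3)] fin by simp
  have ab_notin: "a \<notin> ?S" "b \<notin> ?S" using ab r(2) mid_notin[OF r(1-3)] by auto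
  have "mark (child K x) ?S = new_face_mark K" if "x \<in> {a, b}" for x
  proof -
    have "?S \<in> faces (verts (child K x))" using sub card that by (auto simp: faces_def)
    then show ?thesis using mark_child[of ?S K x] that ab_notin by auto
  qed
  then have "mark (child K a) ?S = mark (child K b) ?S" by simp
  moreover have "solid (child K a) \<inter> solid (child K b) = convex hull ?S"
    using convex_hull_halves_Int[OF r(1-3) ab] by (simp add: verts_child)
  ultimately have "meets_properly (child K a) (child K b)"
    unfolding meets_properly_def using sub card by (intro exI[of _ ?S]) simp
  then show ?thesis
    unfolding separated_def using well_marked_child K ab by blast
qed

text \<open>A proper face of a convex set lies in its relative frontier, hence in its
  frontier.\<close>

lemma subset_solid_frontier:
  assumes "well_marked K" "F \<subseteq> verts K" "card F \<le> 3"
  shows "convex hull F \<subseteq> frontier (solid K)"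
proof -
  have K: "\<not> affine_dependent (verts K)" "card (verts K) = 4"
    using assms(1) by (auto simp: well_marked_def)
  have "verts K \<inter> convex hull F = F" using Int_convex_hull_subset K(1) assms(2) by blast
  moreover have "F \<noteq> verts K" using assms(3) K(2) by auto
  ultimately have "convex hull F \<noteq> solid K" using hull_subset[of "verts K" convex] by auto
  then have "convex hull F \<subseteq> rel_frontier (solid K)"
    using face_of_subset_rel_frontier face_of_subhull[OF K(1) assms(2)] by blast
  also have "\<dots> \<subseteq> frontier (solid K)"
    using interior_subset_rel_interior[of "solid K"] by (auto simp: rel_frontier_def frontier_def)
  finally show ?thesis .
qed

text \<open>The midpoint lies on the common simplex \<open>S\<close>, so \<open>e\<close> does too.
  Let \<open>G\<close> span the face of \<open>K\<close> with the midpoint in its relative interior;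
  \<open>G\<close> and \<open>e\<close> belong to the same bisection tree of \<open>S\<close>, and
  laminarity puts \<open>e\<close> in the hull of \<open>G\<close>, hence on the boundary of
  \<open>K\<close>.\<close>

lemma separated_edge_frontier:
  assumes sep: "separated K K'" and e: "e \<in> edges (verts K')"
    and z: "mid e \<in> solid K" "mid e \<notin> verts K"
  shows "e \<subseteq> frontier (solid K)"
proof -
  obtain A A' S where A: "well_marked A" "child_rel\<^sup>*\<^sup>* A K" and A': "well_marked A'" "child_rel\<^sup>*\<^sup>* A' K'"
    and S: "S \<subseteq> verts A" "S \<subseteq> verts A'" "card S \<le> 3" "solid A \<inter> solid A' = convex hull S"
    and mk: "card S = 3 \<Longrightarrow> mark A S = mark A' S"
    using sep unfolding separated_def meets_properly_def by auto
  let ?H = "convex hull S" and ?F = "verts K \<inter> convex hull S"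
  have e': "e \<subseteq> verts K'" "card e = 2" using e by (auto simp: edges_def)
  have indA: "\<not> affine_dependent (verts A)" "\<not> affine_dependent (verts A')"
    using A(1) A'(1) by (auto simp: well_marked_def)
  note K = descendant_halving[OF A(2,1)] note K' = descendant_halving[OF A'(2,1)]
  have indK: "\<not> affine_dependent (verts K)" using K by (simp add: well_marked_def)
  have finS: "finite S" using S(1) aff_independent_finite[OF indA(1)] finite_subset by blast
  have "convex hull e \<subseteq> solid K'" using e'(1) by (rule hull_mono)
  then have eA': "convex hull e \<subseteq> solid A'" using descendant_solid_subset[OF A'(2,1)] by blast
  have "mid e \<in> solid A'" using mid_in_convex_hull[OF e'(2)] eA' by blast
  moreover have "mid e \<in> solid A" using z(1) descendant_solid_subset[OF A(2,1)] by blast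
  ultimately have zH: "mid e \<in> ?H" using S(4) by blast
  have eH: "e \<subseteq> ?H"
    using face_of_edgeD[OF face_of_subhull[OF indA(2) S(2)] e'(2) _ zH] eA' hull_subset[of e convex]
    by blast
  \<comment> \<open>The trace of \<open>K\<close> on the face spanned by \<open>S\<close> is the
    simplex with vertex set \<open>?F\<close>.\<close>
  have "mid e \<in> convex hull ?F"
    using Int_hull_face[OF indK face_of_subhull[OF indA(1) S(1)]] descendant_solid_subset[OF A(2,1)]
      z(1) zH by blast
  moreover have indF: "\<not> affine_dependent ?F" using indK affine_independent_subset by blast
  ultimately obtain G where G: "G \<subseteq> ?F" "mid e \<in> rel_interior (convex hull G)"
    using in_rel_interior_subhull by blast
  have cF: "card ?F \<le> card S" using card_in_hull_le[OF indF _ finS] by blast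
  have finF: "finite ?F" using indF by (rule aff_independent_finite)
  have GF: "card G \<le> card ?F" using G(1) finF by (rule card_mono[rotated])
  have "card G \<noteq> 0" using G finite_subset[OF G(1) finF] by auto
  \<comment> \<open>A single point would make the midpoint a vertex of \<open>K\<close>.\<close>
  moreover have "card G \<noteq> 1"
  proof
    assume "card G = 1"
    then obtain x where "G = {x}" by (auto simp: card_1_singleton_iff)
    then show False using G z(2) by auto
  qed
  ultimately have G2: "2 \<le> card G" by simp
  have "e \<subseteq> convex hull G"
  proof (cases "card S = 3")
    case False
    \<comment> \<open>The bounds leave exactly two points in \<open>S\<close>, so both traces are
      dyadic parts of one segment.\<close>
    then have c: "card S = 2" "card G = 2" using G2 GF cF S(3) by auto
    have "dyadic_step\<^sup>*\<^sup>* S G"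
      using dyadic_trace[OF _ indA(1) S(1) c(1) _ _ c(2)] K G(1) by blast
    moreover have "dyadic_step\<^sup>*\<^sup>* S e"
      using dyadic_trace[OF _ indA(2) S(2) c(1) e'(1) eH e'(2)] K' by blast
    ultimately show ?thesis using dyadic_laminar c(1) G(2) by blast
  next
    case True
    let ?p = "(S, mark A S)"
    \<comment> \<open>The common mark of \<open>S\<close> places the edge of \<open>K'\<close> in
      the tree belonging to \<open>A\<close>.\<close>
    have "tri_edge ?p e" using face_trace[OF A'(2,1) S(2) True] e' eH mk[OF True] by auto
    then obtain r where r: "tri_step\<^sup>*\<^sup>* ?p r" "e \<subseteq> fst r" unfolding tri_edge_def by blast
    have "\<exists>q. tri_step\<^sup>*\<^sup>* ?p q \<and> G \<subseteq> fst q"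
    proof (cases "card G = 2")
      case True
      then have "tri_edge ?p G" using face_trace[OF A(2,1) S(1) \<open>card S = 3\<close>] G(1) by blast
      then show ?thesis unfolding tri_edge_def by blast
    next
      case False
      \<comment> \<open>Here \<open>G\<close> has three points, so the trace of \<open>K\<close> is
        a full triangle of the tree.\<close>
      then have "card ?F = 3" using G2 GF cF True by simp
      then have "tri_step\<^sup>*\<^sup>* ?p (?F, mark K ?F)" using face_trace[OF A(2,1) S(1) True] by blast
      then show ?thesis using G(1) by (intro exI[of _ "(?F, mark K ?F)"]) simp
    qed
    then show ?thesis
      using tri_laminar r G(2) G2 e'(2) marked_tri_face[OF A(1) S(1) True] by blast
  qed
  also have "convex hull G \<subseteq> convex hull ?F" using G(1) by (rule hull_mono)
  also have "\<dots> \<subseteq> frontier (solid K)"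
    using subset_solid_frontier[of K ?F] K cF S(3) by auto
  finally show ?thesis .
qed

section \<open>Separation throughout a mesh\<close>

definition separated_mesh :: "marked_tet set \<Rightarrow> bool" where
  "separated_mesh T \<longleftrightarrow> (\<forall>K\<in>T. well_marked K) \<and> (\<forall>K\<in>T. \<forall>K'\<in>T. K \<noteq> K' \<longrightarrow> separated K K')"

text \<open>The four alternatives of conformity give a common subsimplex \<open>S\<close> with zero,
  one, two or three points.\<close>

lemma conformingly_marked_meets_properly:
  assumes "conformingly_marked \<Omega> T" "K \<in> T" "K' \<in> T" "K \<noteq> K'"
  shows "meets_properly K K'"
proof -
  have c: "conforming T" and m: "\<forall>F\<in>faces (verts K) \<inter> faces (verts K'). mark K F = mark K' F"
    using assms unfolding conformingly_marked_def by blast+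
  have "\<exists>S. S \<subseteq> verts K \<inter> verts K' \<and> card S \<le> 3 \<and> solid K \<inter> solid K' = convex hull S"
    using c[unfolded conforming_def, rule_format, OF assms(2-4)]
  proof (elim disjE bexE)
    assume "solid K \<inter> solid K' = {}"
    then show ?thesis by (intro exI[of _ "{}"]) simp
  next
    fix v assume "v \<in> verts K \<inter> verts K'" "solid K \<inter> solid K' = {v}"
    then show ?thesis by (intro exI[of _ "{v}"]) simp
  next
    fix e assume "e \<in> edges (verts K) \<inter> edges (verts K')" "solid K \<inter> solid K' = convex hull e"
    then show ?thesis by (intro exI[of _ e]) (auto simp: edges_def)
  next
    fix F assume "F \<in> faces (verts K) \<inter> faces (verts K')" "solid K \<inter> solid K' = convex hull F"
    then show ?thesis by (intro exI[of _ F]) (auto simp: faces_def)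
  qed
  then show ?thesis unfolding meets_properly_def using m by (auto simp: faces_def)
qed

lemma conformingly_marked_well_marked:
  "conformingly_marked \<Omega> T \<Longrightarrow> K \<in> T \<Longrightarrow> well_marked K"
  by (auto simp: conformingly_marked_def amp_mesh_of_def is_marked_tet_well_marked)

lemma conformingly_marked_separated:
  assumes "conformingly_marked \<Omega> T"
  shows "separated_mesh T"
  unfolding separated_mesh_def separated_def
  using conformingly_marked_meets_properly[OF assms] conformingly_marked_well_marked[OF assms]
  by blast

text \<open>Puts children and untouched elements on the same footing: the reflexive closure lets an
  element outside \<open>B\<close> be its own parent.\<close>

lemma bisect_batch_parent:
  assumes "C \<in> bisect_batch T B" "B \<subseteq> T"
  obtains P where "P \<in> T" "child_rel\<^sup>*\<^sup>* P C" "P \<in> B \<Longrightarrow> C \<in> children P" "P \<notin> B \<Longrightarrow> C = P"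
proof (cases "C \<in> T - B")
  case True
  then show thesis using that[of C] by auto
next
  case False
  then obtain P where "P \<in> B" "C \<in> children P" using assms(1) by (auto simp: bisect_batch_def)
  then have "child_rel\<^sup>*\<^sup>* P C" by (simp add: child_rel_def r_into_rtranclp)
  then show thesis using that[of P] \<open>P \<in> B\<close> \<open>C \<in> children P\<close> assms(2) by blast
qed

text \<open>Elements with different parents inherit separation; distinct elements with one parent
  are siblings.\<close>

lemma separated_bisect_batch:
  assumes T: "separated_mesh T" and B: "B \<subseteq> T"
  shows "separated_mesh (bisect_batch T B)"
  unfolding separated_mesh_def
proof (intro conjI ballI impI)
  fix C assume "C \<in> bisect_batch T B"
  then obtain P where "P \<in> T" "child_rel\<^sup>*\<^sup>* P C" using B bisect_batch_parent by metis
  then show "well_marked C" using T descendant_halving by (auto simp: separated_mesh_def)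
next
  fix C C' assume C: "C \<in> bisect_batch T B" and C': "C' \<in> bisect_batch T B" and ne: "C \<noteq> C'"
  obtain P where P: "P \<in> T" "child_rel\<^sup>*\<^sup>* P C" "P \<in> B \<Longrightarrow> C \<in> children P" "P \<notin> B \<Longrightarrow> C = P"
    using bisect_batch_parent[OF C B] by metis
  obtain P' where P': "P' \<in> T" "child_rel\<^sup>*\<^sup>* P' C'" "P' \<in> B \<Longrightarrow> C' \<in> children P'" "P' \<notin> B \<Longrightarrow> C' = P'"
    using bisect_batch_parent[OF C' B] by metis
  show "separated C C'"
  proof (cases "P = P'")
    case True
    then have "P \<in> B" using ne P(4) P'(4) by blast
    then obtain a b where "a \<in> redge P" "b \<in> redge P" "C = child P a" "C' = child P b"
      using True P(3) P'(3) unfolding children_def by blast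
    moreover have "well_marked P" using P(1) T by (simp add: separated_mesh_def)
    ultimately show ?thesis using separated_siblings ne by blast
  next
    case False
    then have "separated P P'" using T P(1) P'(1) by (simp add: separated_mesh_def)
    then show ?thesis using separated_descendants P(2) P'(2) by blast
  qed
qed

section \<open>The refinement call\<close>

lemma next_batch_subset: "M \<subseteq> T \<Longrightarrow> next_batch M n (refine_mesh T M n) \<subseteq> refine_mesh T M n"
  by (auto simp: next_batch_def)

lemma refine_mesh_separated:
  assumes "separated_mesh T" "M \<subseteq> T"
  shows "separated_mesh (refine_mesh T M n)"
  using assms by (induction n) (simp_all add: separated_bisect_batch next_batch_subset)

lemma refine_mesh_ancestor:
  assumes "k \<le> n" "M \<subseteq> T" "K \<in> refine_mesh T M n"
  obtains L where "L \<in> refine_mesh T M k" "child_rel\<^sup>*\<^sup>* L K"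
proof -
  have "\<exists>L\<in>refine_mesh T M k. child_rel\<^sup>*\<^sup>* L K"
    using assms(1,3)
  proof (induction n arbitrary: K rule: dec_induct)
    case (step n)
    from step.prems have "K \<in> bisect_batch (refine_mesh T M n) (next_batch M n (refine_mesh T M n))"
      by simp
    then obtain P where "P \<in> refine_mesh T M n" "child_rel\<^sup>*\<^sup>* P K"
      using bisect_batch_parent next_batch_subset[OF assms(2)] by metis
    then show ?case using step.IH by (meson rtranclp_trans)
  qed auto
  then show thesis using that by blast
qed

lemma mesh_verts_bisect_batch:
  assumes "\<forall>K\<in>B. well_marked K"
  shows "mesh_verts T \<subseteq> mesh_verts (bisect_batch T B)"
proof
  fix v assume "v \<in> mesh_verts T"
  then obtain K where K: "K \<in> T" "v \<in> verts K" by (auto simp: mesh_verts_def)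
  show "v \<in> mesh_verts (bisect_batch T B)"
  proof (cases "K \<in> B")
    case False
    then show ?thesis using K by (auto simp: mesh_verts_def bisect_batch_def)
  next
    case True
    then have "card (redge K) = 2" using assms by (auto simp: well_marked_def edges_def)
    \<comment> \<open>The child at \<open>a\<close> contains \<open>v\<close>: \<open>a\<close> is
      \<open>v\<close> itself if \<open>v\<close> lies on the refinement edge, and arbitrary
      otherwise.\<close>
    then obtain a where a: "a \<in> redge K" "v \<in> redge K \<longrightarrow> v = a"
      by (metis card.empty ex_in_conv zero_neq_numeral)
    then have "v \<in> verts (child K a)" using K(2) by (auto simp: verts_child halve_def)
    then show ?thesis using a True by (auto simp: mesh_verts_def bisect_batch_def children_def)
  qed
qed

lemma mesh_verts_refine_mesh_mono:
  assumes "separated_mesh T" "M \<subseteq> T" "k \<le> n"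
  shows "mesh_verts (refine_mesh T M k) \<subseteq> mesh_verts (refine_mesh T M n)"
  using assms(3)
proof (induction n rule: dec_induct)
  case (step n)
  have "\<forall>K\<in>next_batch M n (refine_mesh T M n). well_marked K"
    using refine_mesh_separated[OF assms(1,2)] next_batch_subset[OF assms(2)]
    unfolding separated_mesh_def by blast
  then show ?case using mesh_verts_bisect_batch step.IH by fastforce
qed simp

theorem lemma3p7:
  fixes \<Omega> :: "(real^3) set" and T\<^sub>0 T M :: "marked_tet set" and n :: nat and K :: marked_tet
  assumes "polyhedral_domain \<Omega>"
    and "initial_amp_mesh \<Omega> T\<^sub>0"
    and "descendant_mesh T\<^sub>0 T"
    and "conformingly_marked \<Omega> T"
    and "M \<subseteq> T"
    and "refine_event T M n K" and "n > 0"
  shows "\<exists>e\<in>edges (verts K). \<exists>b. b = mid e \<and> hanging_vertex (refine_mesh T M n) K b \<and>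
           (\<exists>k<n. \<exists>K'. refine_event T M k K' \<and> redge K' = e \<and> event_creates T M k K' b)"
proof -
  note conf = assms(4) and M = assms(5)
  have sepT: "separated_mesh T" using conf by (rule conformingly_marked_separated)
  note sep = refine_mesh_separated[OF sepT M]
  let ?T = "refine_mesh T M"
  \<comment> \<open>A set fixed by \<open>K\<close> and tested against every earlier mesh, although
    \<open>K\<close> itself may not be an element of those meshes.\<close>
  let ?hang = "frontier (solid K) - verts K"
  have K: "K \<in> ?T n" and "\<exists>z. hanging_vertex (?T n) K z"
    using assms(6,7) by (auto simp: refine_event_def next_batch_def)
  then have ex: "\<exists>j\<le>n. mesh_verts (?T j) \<inter> ?hang \<noteq> {}" by (auto simp: hanging_vertex_def)
  \<comment> \<open>The first mesh with a vertex in this set; the vertex found there may differ from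
    the one that triggers the event.\<close>
  define j where "j = (LEAST j. mesh_verts (?T j) \<inter> ?hang \<noteq> {})"
  have jn: "j \<le> n" using ex unfolding j_def by (meson Least_le order_trans)
  have "mesh_verts (?T j) \<inter> ?hang \<noteq> {}" 
    unfolding j_def by (rule LeastI_ex) (use ex in blast)
  then obtain z where z: "z \<in> mesh_verts (?T j)" "z \<in> frontier (solid K)" "z \<notin> verts K" by blast
  have first: "mesh_verts (?T i) \<inter> ?hang = {}" if "i < j" for i
    using not_less_Least that unfolding j_def by blast
  have wm: "well_marked L" if "L \<in> ?T i" for L i using sep that by (auto simp: separated_mesh_def)
  have "finite (verts K)"
    using wm[OF K] aff_independent_finite unfolding well_marked_def by blast
  then have "closed (solid K)"
    by (intro compact_imp_closed compact_convex_hull finite_imp_compact)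
  then have zK: "z \<in> solid K" using z(2) frontier_subset_closed by blast
  obtain L where L: "L \<in> ?T j" "z \<in> verts L" using z(1) by (auto simp: mesh_verts_def)
  \<comment> \<open>In the input mesh conformity makes \<open>z\<close> a vertex of the ancestor of
    \<open>K\<close>; a vertex of an ancestor that lies in the solid of \<open>K\<close> is a vertex
    of \<open>K\<close>.\<close>
  have "j \<noteq> 0"
  proof
    assume "j = 0"
    then have LT: "L \<in> T" using L(1) by simp
    obtain K0 where K0: "K0 \<in> T" "child_rel\<^sup>*\<^sup>* K0 K"
      using refine_mesh_ancestor[OF _ M K, of 0] by auto
    have w: "well_marked K0" "well_marked L" using wm[of _ 0] K0 LT by auto
    have "z \<in> verts K0"
    proof (cases "K0 = L")
      case False
      then obtain S where S: "S \<subseteq> verts K0" "S \<subseteq> verts L" "solid K0 \<inter> solid L = convex hull S"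
        using conformingly_marked_meets_properly[OF conf K0(1) LT] unfolding meets_properly_def by auto
      have "z \<in> solid K0" using zK descendant_solid_subset[OF K0(2) w(1)] by blast
      moreover have "z \<in> solid L" using L(2) by (rule hull_inc)
      ultimately have "z \<in> verts L \<inter> convex hull S" using L(2) S(3) by blast
      then show ?thesis
        using Int_convex_hull_subset[of "verts L" S] S w(2) by (auto simp: well_marked_def)
    qed (use L in simp)
    then show False using descendant_vertex[OF K0(2) w(1) _ zK] z(3) by blast
  qed
  then obtain k where k: "j = Suc k" by (cases j) auto
  let ?B = "next_batch M k (?T k)"
  have kn: "k < n" using jn k by simp
  have B: "?B \<subseteq> ?T k" using next_batch_subset[OF M] .
  have zk: "z \<notin> mesh_verts (?T k)" using first[of k] k z(2,3) by blast
  have Lb: "L \<in> bisect_batch (?T k) ?B" using L(1) k by simp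
  have "L \<notin> ?T k" using zk L(2) by (auto simp: mesh_verts_def)
  then obtain K' where K': "K' \<in> ?B" "L \<in> children K'" using Lb by (auto simp: bisect_batch_def)
  have "z \<notin> verts K'" using zk K' B by (auto simp: mesh_verts_def)
  moreover obtain a where "a \<in> redge K'" "L = child K' a" using K'(2) by (auto simp: children_def)
  \<comment> \<open>A child has only one vertex that its parent lacks.\<close>
  ultimately have zm: "z = mid (redge K')" using L(2) by (auto simp: verts_child halve_def)
  have wK': "well_marked K'" using K'(1) B wm by blast
  then have e: "redge K' \<in> edges (verts K')" by (simp add: well_marked_def)
  \<comment> \<open>\<open>P\<close> and \<open>N\<close> are the ancestors of \<open>K\<close> just
    before and just after batch \<open>k\<close>.\<close>
  obtain N where N: "N \<in> ?T (Suc k)" "child_rel\<^sup>*\<^sup>* N K"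
    using refine_mesh_ancestor[OF _ M K, of "Suc k"] kn by auto
  obtain P where P: "P \<in> ?T k" "child_rel\<^sup>*\<^sup>* P N" "P \<in> ?B \<Longrightarrow> N \<in> children P"
    using bisect_batch_parent[OF _ B] N(1) by (metis refine_mesh.simps(2))
  \<comment> \<open>Otherwise \<open>N\<close> would be a child of \<open>K'\<close> with vertex
    \<open>z\<close>, and \<open>K\<close> would have this vertex too.\<close>
  have "P \<noteq> K'"
  proof
    assume "P = K'"
    then obtain c where "N = child K' c" using P(3) K'(1) by (auto simp: children_def)
    then have "z \<in> verts N" by (simp add: zm verts_child halve_def)
    then show False using descendant_vertex[OF N(2) wm[OF N(1)] _ zK] z(3) by blast
  qed
  then have "separated P K'" using sep P(1) K'(1) B by (auto simp: separated_mesh_def)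
  then have "separated K K'" using separated_descendants P(2) N(2) by (meson rtranclp_trans rtranclp.rtrancl_refl)
  then have fr: "redge K' \<subseteq> frontier (solid K)"
    using separated_edge_frontier e zK z(3) zm by blast
  have "redge K' \<subseteq> mesh_verts (?T k)" using e K'(1) B by (auto simp: edges_def mesh_verts_def)
  \<comment> \<open>Minimality of \<open>j\<close>: the endpoints are mesh vertices before batch
    \<open>k\<close> and lie on the boundary of \<open>K\<close>, so they are vertices of
    \<open>K\<close>.\<close>
  then have "redge K' \<subseteq> verts K" using fr first[of k] k by blast
  then have edge: "redge K' \<in> edges (verts K)" using e by (auto simp: edges_def)
  have "z \<in> mesh_verts (?T n)" using mesh_verts_refine_mesh_mono[OF sepT M jn] z(1) by blast
  then have "hanging_vertex (?T n) K z" using z by (simp add: hanging_vertex_def)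
  moreover have "refine_event T M k K'" using K'(1) by (simp add: refine_event_def)
  moreover have "event_creates T M k K' z"
    using L(2) K'(2) zk by (auto simp: event_creates_def mesh_verts_def)
  ultimately show ?thesis using edge zm kn by blast
qed

end
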